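(* \begin{enumerate} \item In a left (resp. right) ternary Moufang loop $M$, for every $e\in M$ the homotope $x\cdot z:=(xez)$ at $e$ is a binary Moufang loop. \item Every left ternary Moufang loop can be recovered from its homotope $xz=(xez)$ at any $e\in M$ via $(xyz)=x(y^{-1}z)$, where $y^{-1}=(eye)$; and every right ternary Moufang loop via $(xyz)=(xy^{-1})z$. \item In a left ternary Moufang loop, $(B_{a,b},B_{a,b},L_{a,b};L_{a,b})$ is an autotopy for all $a,b$; in a right ternary Moufang loop, $(R_{a,b},B_{a,b},B_{a,b};R_{a,b})$ is an autotopy for all $a,b$. \item Both left and right ternary Moufang loops are reflection spaces when equipped with the binary product $\mu(x,y):=S_{x,x}(y)=(xyx)=x(y^{-1}x)=(xy^{-1})x$ (the last two expressions computed in any homotope). In a left ternary Moufang loop, the set of right multiplications $\{R_{a,b}\}$ is stable under the composition $(f,g)\mapsto fg^{-1}f$, and in a right ternary Moufang loop, the set of left multiplications $\{L_{a,b}\}$ is stable under this composition. \end{enumerate}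
   Context: For a ternary product $M^3\to M$, $(x,y,z)\mapsto(xyz)$, on a set $M$, define maps by $(xyz)=L_{x,y}(z)=R_{z,y}(x)=S_{x,z}(y)$. It is a ternary loop if all $L_{x,y},R_{x,y},S_{x,y}$ are bijective and $(xyy)=x=(yyx)$. A ternary inverse loop is a ternary loop such that for all $x,y$: $L_{x,y}\circ L_{(yxy),y}=\mathrm{id}=L_{(yxy),y}\circ L_{x,y}$ and $R_{x,y}\circ R_{(yxy),y}=\mathrm{id}=R_{(yxy),y}\circ R_{x,y}$; then one puts $B_{a,b}:=L_{a,b}\circ R_{a,b}=R_{a,b}\circ L_{a,b}$. A left ternary Moufang loop is a ternary inverse loop satisfying the left Chasles relation $(xy(yzu))=(xzu)$ and the identity $((xba)(yba)(zab))=((xyz)ab)$. A right ternary Moufang loop is a ternary inverse loop satisfying the right Chasles relation $((uzy)yx)=(uzx)$ and the identity $((abx)(bay)(baz))=(ab(xyz))$. An autotopy of a ternary product is a quadruple $(f_1,f_2,f_3;f_0)$ of bijections of $M$ with $f_0((xyz))=(f_1(x)\,f_2(y)\,f_3(z))$ for all $x,y,z$. A binary Moufang loop is a set with a binary product having a unit element and all left and right multiplications bijective, such that $(ax)(ya)=a((xy)a)$ for all $a,x,y$. A reflection space is a set $M$ with a product $\mu(x,y)=\sigma_x(y)$ such that $\sigma_x(x)=x$, $\sigma_x\circ\sigma_x=\mathrm{id}$, $\sigma_x\circ\sigma_y\circ\sigma_x=\sigma_{\sigma_x(y)}$. *)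

theory Defs
  imports Main "HOL-Library.FuncSet"
begin

text \<open>
  A ternary product on a carrier set \<open>M\<close> is a function \<open>t\<close>, with \<open>t x y z\<close> standing for \<open>(xyz)\<close>.
  Self-maps of \<open>M\<close> are taken extensional (undefined outside \<open>M\<close>), so that equality of maps
  is equality of HOL functions. Beware of the index order: \<open>R\<^bsub>z,y\<^esub>(x) = S\<^bsub>x,z\<^esub>(y) = (xyz)\<close>.
\<close>

type_synonym 'a ternary = "'a \<Rightarrow> 'a \<Rightarrow> 'a \<Rightarrow> 'a"

definition Lmap :: "'a set \<Rightarrow> 'a ternary \<Rightarrow> 'a \<Rightarrow> 'a \<Rightarrow> 'a \<Rightarrow> 'a" where
  "Lmap M t x y = (\<lambda>z\<in>M. t x y z)"

definition Rmap :: "'a set \<Rightarrow> 'a ternary \<Rightarrow> 'a \<Rightarrow> 'a \<Rightarrow> 'a \<Rightarrow> 'a" where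
  "Rmap M t z y = (\<lambda>x\<in>M. t x y z)"

definition Smap :: "'a set \<Rightarrow> 'a ternary \<Rightarrow> 'a \<Rightarrow> 'a \<Rightarrow> 'a \<Rightarrow> 'a" where
  "Smap M t x z = (\<lambda>y\<in>M. t x y z)"

locale ternary_loop =
  fixes M :: "'a set" and t :: "'a ternary"
  assumes closed: "\<lbrakk>x \<in> M; y \<in> M; z \<in> M\<rbrakk> \<Longrightarrow> t x y z \<in> M"
    and bij_L: "\<lbrakk>x \<in> M; y \<in> M\<rbrakk> \<Longrightarrow> bij_betw (Lmap M t x y) M M"
    and bij_R: "\<lbrakk>x \<in> M; y \<in> M\<rbrakk> \<Longrightarrow> bij_betw (Rmap M t x y) M M"
    and bij_S: "\<lbrakk>x \<in> M; y \<in> M\<rbrakk> \<Longrightarrow> bij_betw (Smap M t x y) M M"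
    and idem_right: "\<lbrakk>x \<in> M; y \<in> M\<rbrakk> \<Longrightarrow> t x y y = x"
    and idem_left: "\<lbrakk>x \<in> M; y \<in> M\<rbrakk> \<Longrightarrow> t y y x = x"

locale ternary_inverse_loop = ternary_loop +
  assumes L_inverse_right: "\<lbrakk>x \<in> M; y \<in> M\<rbrakk> \<Longrightarrow>
      compose M (Lmap M t x y) (Lmap M t (t y x y) y) = (\<lambda>z\<in>M. z)"
    and L_inverse_left: "\<lbrakk>x \<in> M; y \<in> M\<rbrakk> \<Longrightarrow>
      compose M (Lmap M t (t y x y) y) (Lmap M t x y) = (\<lambda>z\<in>M. z)"
    and R_inverse_right: "\<lbrakk>x \<in> M; y \<in> M\<rbrakk> \<Longrightarrow>
      compose M (Rmap M t x y) (Rmap M t (t y x y) y) = (\<lambda>z\<in>M. z)"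
    and R_inverse_left: "\<lbrakk>x \<in> M; y \<in> M\<rbrakk> \<Longrightarrow>
      compose M (Rmap M t (t y x y) y) (Rmap M t x y) = (\<lambda>z\<in>M. z)"

text \<open>
  In a general ternary inverse loop \<open>L\<^bsub>a,b\<^esub>\<close> and \<open>R\<^bsub>a,b\<^esub>\<close> are not assumed to commute; where
  \<open>B\<^bsub>a,b\<^esub>\<close> is used, \<open>L\<^bsub>a,b\<^esub> \<circ> R\<^bsub>a,b\<^esub> = R\<^bsub>a,b\<^esub> \<circ> L\<^bsub>a,b\<^esub>\<close> is asserted along with the result.
\<close>

definition Bmap :: "'a set \<Rightarrow> 'a ternary \<Rightarrow> 'a \<Rightarrow> 'a \<Rightarrow> 'a \<Rightarrow> 'a" where
  "Bmap M t a b = compose M (Lmap M t a b) (Rmap M t a b)"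

locale left_ternary_Moufang_loop = ternary_inverse_loop +
  assumes left_Chasles: "\<lbrakk>x \<in> M; y \<in> M; z \<in> M; u \<in> M\<rbrakk> \<Longrightarrow> t x y (t y z u) = t x z u"
    and left_Moufang: "\<lbrakk>x \<in> M; y \<in> M; z \<in> M; a \<in> M; b \<in> M\<rbrakk> \<Longrightarrow>
      t (t x b a) (t y b a) (t z a b) = t (t x y z) a b"

locale right_ternary_Moufang_loop = ternary_inverse_loop +
  assumes right_Chasles: "\<lbrakk>x \<in> M; y \<in> M; z \<in> M; u \<in> M\<rbrakk> \<Longrightarrow> t (t u z y) y x = t u z x"
    and right_Moufang: "\<lbrakk>x \<in> M; y \<in> M; z \<in> M; a \<in> M; b \<in> M\<rbrakk> \<Longrightarrow>
      t (t a b x) (t b a y) (t b a z) = t a b (t x y z)"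

definition homotope :: "'a ternary \<Rightarrow> 'a \<Rightarrow> 'a \<Rightarrow> 'a \<Rightarrow> 'a" where
  "homotope t e x z = t x e z"

definition autotopy ::
  "'a set \<Rightarrow> 'a ternary \<Rightarrow> ('a \<Rightarrow> 'a) \<Rightarrow> ('a \<Rightarrow> 'a) \<Rightarrow> ('a \<Rightarrow> 'a) \<Rightarrow> ('a \<Rightarrow> 'a) \<Rightarrow> bool" where
  "autotopy M t f1 f2 f3 f0 \<longleftrightarrow>
     bij_betw f1 M M \<and> bij_betw f2 M M \<and> bij_betw f3 M M \<and> bij_betw f0 M M \<and>
     (\<forall>x\<in>M. \<forall>y\<in>M. \<forall>z\<in>M. f0 (t x y z) = t (f1 x) (f2 y) (f3 z))"

definition is_unit_of :: "'a set \<Rightarrow> ('a \<Rightarrow> 'a \<Rightarrow> 'a) \<Rightarrow> 'a \<Rightarrow> bool" where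
  "is_unit_of M p u \<longleftrightarrow> u \<in> M \<and> (\<forall>x\<in>M. p u x = x \<and> p x u = x)"

definition is_inverse_of :: "'a set \<Rightarrow> ('a \<Rightarrow> 'a \<Rightarrow> 'a) \<Rightarrow> 'a \<Rightarrow> 'a \<Rightarrow> bool" where
  "is_inverse_of M p y' y \<longleftrightarrow>
     y \<in> M \<and> y' \<in> M \<and> is_unit_of M p (p y y') \<and> is_unit_of M p (p y' y)"

locale binary_Moufang_loop =
  fixes M :: "'a set" and p :: "'a \<Rightarrow> 'a \<Rightarrow> 'a"
  assumes closed: "\<lbrakk>x \<in> M; y \<in> M\<rbrakk> \<Longrightarrow> p x y \<in> M"
    and unit: "\<exists>u. is_unit_of M p u"
    and bij_left: "a \<in> M \<Longrightarrow> bij_betw (\<lambda>x. p a x) M M"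
    and bij_right: "a \<in> M \<Longrightarrow> bij_betw (\<lambda>x. p x a) M M"
    and Moufang: "\<lbrakk>a \<in> M; x \<in> M; y \<in> M\<rbrakk> \<Longrightarrow> p (p a x) (p y a) = p a (p (p x y) a)"

locale reflection_space =
  fixes M :: "'a set" and \<mu> :: "'a \<Rightarrow> 'a \<Rightarrow> 'a"
  assumes closed: "\<lbrakk>x \<in> M; y \<in> M\<rbrakk> \<Longrightarrow> \<mu> x y \<in> M"
    and fixpoint: "x \<in> M \<Longrightarrow> \<mu> x x = x"
    and involutive: "\<lbrakk>x \<in> M; y \<in> M\<rbrakk> \<Longrightarrow> \<mu> x (\<mu> x y) = y"
    and conjugation: "\<lbrakk>x \<in> M; y \<in> M; z \<in> M\<rbrakk> \<Longrightarrow> \<mu> x (\<mu> y (\<mu> x z)) = \<mu> (\<mu> x y) z"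

definition stable_fginvf :: "'a set \<Rightarrow> ('a \<Rightarrow> 'a) set \<Rightarrow> bool" where
  "stable_fginvf M F \<longleftrightarrow>
     (\<forall>f\<in>F. \<forall>g\<in>F. compose M f (compose M (restrict (inv_into M g) M) f) \<in> F)"

end

theory Submission
  imports Defs
begin

text \<open>
  By the left Chasles relation and the inverse laws, every homotope of a left ternary Moufang loop
  is a loop with the inverse property and \<open>(xyz) = x(y\<^sup>-\<^sup>1z)\<close>. The left Moufang identity at \<open>b = e\<close> and
  \<open>y = e\<close> is then the right Bol identity, which together with the inverse property yields all
  Moufang identities. Each claimed ternary identity becomes a short computation in
  the homotope at a suitable base point. Right ternary Moufang loops are the opposites of left ones.
\<close>

section \<open>Binary loops: inverse property, Bol and Moufang identities, opposites\<close>

locale inverse_property_Bol_loop =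
  fixes M :: "'a set" and p :: "'a \<Rightarrow> 'a \<Rightarrow> 'a" (infixl "\<cdot>" 70) and i :: "'a \<Rightarrow> 'a" and e :: 'a
  assumes closed [simp]: "\<lbrakk>x \<in> M; y \<in> M\<rbrakk> \<Longrightarrow> x \<cdot> y \<in> M"
    and inv_closed [simp]: "x \<in> M \<Longrightarrow> i x \<in> M"
    and unit_closed [simp]: "e \<in> M"
    and left_unit [simp]: "x \<in> M \<Longrightarrow> e \<cdot> x = x"
    and right_unit [simp]: "x \<in> M \<Longrightarrow> x \<cdot> e = x"
    and left_inv [simp]: "\<lbrakk>x \<in> M; y \<in> M\<rbrakk> \<Longrightarrow> i x \<cdot> (x \<cdot> y) = y"
    and right_inv [simp]: "\<lbrakk>x \<in> M; y \<in> M\<rbrakk> \<Longrightarrow> y \<cdot> x \<cdot> i x = y"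
    and right_Bol: "\<lbrakk>x \<in> M; b \<in> M; z \<in> M\<rbrakk> \<Longrightarrow> x \<cdot> b \<cdot> z \<cdot> b = x \<cdot> (b \<cdot> (z \<cdot> b))"
begin

lemma inv_mult_self [simp]: "x \<in> M \<Longrightarrow> i x \<cdot> x = e"
  using left_inv[of x e] by simp

lemma mult_self_inv [simp]: "x \<in> M \<Longrightarrow> x \<cdot> i x = e"
  using right_inv[of x e] by simp

lemma inv_inv [simp]: "x \<in> M \<Longrightarrow> i (i x) = x"
  using left_inv[of "i x" x] by simp

lemma left_inv' [simp]: "\<lbrakk>x \<in> M; y \<in> M\<rbrakk> \<Longrightarrow> x \<cdot> (i x \<cdot> y) = y"
  using left_inv[of "i x" y] by simp

lemma right_inv' [simp]: "\<lbrakk>x \<in> M; y \<in> M\<rbrakk> \<Longrightarrow> y \<cdot> i x \<cdot> x = y"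
  using right_inv[of "i x" y] by simp

text \<open>Since \<open>x = (xy)y^-1\<close>, cancelling \<open>xy\<close> on the left gives
  \<open>(xy)^-1 x = y^-1\<close>; multiply by \<open>x^-1\<close> on the right.\<close>

lemma inv_mult: assumes "x \<in> M" "y \<in> M" shows "i (x \<cdot> y) = i y \<cdot> i x"
proof -
  have "i (x \<cdot> y) \<cdot> x = i y"
    using left_inv[of "x \<cdot> y" "i y"] assms by simp
  then show ?thesis
    using right_inv[of x "i (x \<cdot> y)"] assms by simp
qed

lemma flexible: "\<lbrakk>b \<in> M; z \<in> M\<rbrakk> \<Longrightarrow> b \<cdot> z \<cdot> b = b \<cdot> (z \<cdot> b)"
  using right_Bol[of e b z] by simp

text \<open>Inversion is an anti-automorphism, so it carries the right Bol identity for
  \<open>x^-1\<close>, \<open>b^-1\<close>, \<open>z^-1\<close> to its mirror image.\<close>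

lemma left_Bol:
  assumes "x \<in> M" "b \<in> M" "z \<in> M"
  shows "b \<cdot> (z \<cdot> b) \<cdot> x = b \<cdot> (z \<cdot> (b \<cdot> x))"
proof -
  have "i (i x \<cdot> i b \<cdot> i z \<cdot> i b) = i (i x \<cdot> (i b \<cdot> (i z \<cdot> i b)))"
    using right_Bol[of "i x" "i b" "i z"] assms by simp
  then show ?thesis
    using assms by (simp add: inv_mult flexible)
qed

lemma middle_Moufang:
  assumes "a \<in> M" "x \<in> M" "y \<in> M"
  shows "(a \<cdot> x) \<cdot> (y \<cdot> a) = a \<cdot> (x \<cdot> y \<cdot> a)"
proof -
  \<comment> \<open>\<open>uv = w\<close> with \<open>u = x\<^sup>-\<^sup>1a\<^sup>-\<^sup>1\<close> and \<open>v = a(xy \<cdot> a)\<close> is an instance of right Bol; solve it for \<open>v\<close>.\<close>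
  have "i x \<cdot> i a \<cdot> (a \<cdot> (x \<cdot> y \<cdot> a)) = i x \<cdot> i a \<cdot> a \<cdot> (x \<cdot> y) \<cdot> a"
    using right_Bol[of "i x \<cdot> i a" a "x \<cdot> y"] assms by simp
  also have "\<dots> = y \<cdot> a"
    using assms by simp
  finally have "a \<cdot> x \<cdot> (y \<cdot> a) = i (i x \<cdot> i a) \<cdot> (i x \<cdot> i a \<cdot> (a \<cdot> (x \<cdot> y \<cdot> a)))"
    using assms by (simp add: inv_mult)
  then show ?thesis
    using assms by simp
qed

lemma bij_left_mult: "a \<in> M \<Longrightarrow> bij_betw (\<lambda>x. a \<cdot> x) M M"
  by (rule bij_betw_byWitness[where f' = "\<lambda>x. i a \<cdot> x"]) auto

lemma bij_right_mult: "a \<in> M \<Longrightarrow> bij_betw (\<lambda>x. x \<cdot> a) M M"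
  by (rule bij_betw_byWitness[where f' = "\<lambda>x. x \<cdot> i a"]) auto

lemma is_unit: "is_unit_of M p e"
  by (simp add: is_unit_of_def)

lemma is_inverse: "y \<in> M \<Longrightarrow> is_inverse_of M p (i y) y"
  using is_unit by (simp add: is_inverse_of_def)

lemma is_binary_Moufang_loop: "binary_Moufang_loop M p"
  using is_unit by unfold_locales (auto simp: bij_left_mult bij_right_mult middle_Moufang)

end

text \<open>Reversing all factors changes only the bracketing of the right-hand side of the Moufang
  identity. Flexibility, the Moufang identity with the unit for \<open>y\<close>, makes the two
  bracketings agree.\<close>

lemma (in binary_Moufang_loop) opposite: "binary_Moufang_loop M (\<lambda>x y. p y x)"
proof -
  obtain u where u: "is_unit_of M p u"
    using unit by blast
  have flex: "p (p a x) a = p a (p x a)" if "a \<in> M" "x \<in> M" for a x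
    using Moufang[of a x u] u that by (simp add: is_unit_of_def)
  have "is_unit_of M (\<lambda>x y. p y x) u"
    using u by (simp add: is_unit_of_def)
  then show ?thesis
    by unfold_locales (auto simp: closed bij_left bij_right Moufang flex)
qed

lemma is_inverse_of_opposite: "is_inverse_of M (\<lambda>x y. p y x) y' y \<longleftrightarrow> is_inverse_of M p y' y"
  by (auto simp: is_inverse_of_def is_unit_of_def)

section \<open>Left ternary Moufang loops through their homotopes\<close>

context left_ternary_Moufang_loop
begin

text \<open>Evaluated at points, the inverse laws for \<open>L\<close> become the left inverse
  property of the homotope at \<open>e\<close>, with \<open>t e y e\<close> as \<open>y^-1\<close>;
  the laws for \<open>R\<close> give the right one below.\<close>

lemma L_inverses:
  assumes "e \<in> M" "y \<in> M" "z \<in> M"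
  shows "t y e (t (t e y e) e z) = z" "t (t e y e) e (t y e z) = z"
  using fun_cong[OF L_inverse_right[of y e], of z] fun_cong[OF L_inverse_left[of y e], of z] assms
  by (simp_all add: compose_def Lmap_def closed)

lemma R_inverses:
  assumes "e \<in> M" "y \<in> M" "z \<in> M"
  shows "t (t z e (t e y e)) e y = z" "t (t z e y) e (t e y e) = z"
  using fun_cong[OF R_inverse_right[of y e], of z] fun_cong[OF R_inverse_left[of y e], of z] assms
  by (simp_all add: compose_def Rmap_def closed)

text \<open>By left Chasles, multiplying \<open>(eyz)\<close> on the left by \<open>y\<close> in the
  homotope gives \<open>(yyz) = z\<close>; now cancel \<open>y\<close>.\<close>

lemma base_left_mult:
  assumes "e \<in> M" "y \<in> M" "z \<in> M"
  shows "t e y z = t (t e y e) e z"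
  using L_inverses(2)[of e y "t e y z"] left_Chasles[of y e y z] idem_left[of z y] assms
  by (simp add: closed)

lemma product_via_homotope:
  assumes "e \<in> M" "x \<in> M" "y \<in> M" "z \<in> M"
  shows "t x y z = homotope t e x (homotope t e (t e y e) z)"
  using left_Chasles[of x e y z] base_left_mult[of e y z] assms by (simp add: homotope_def)

lemma homotope_is_Bol_loop:
  assumes e: "e \<in> M"
  shows "inverse_property_Bol_loop M (homotope t e) (\<lambda>y. t e y e) e"
proof
  fix x b z assume *: "x \<in> M" "b \<in> M" "z \<in> M"
  let ?i = "\<lambda>y. t e y e" and ?p = "homotope t e"
  have inv: "?p x (?i x) = e" "?i (?i x) = x" if "x \<in> M" for x
  proof -
    show "?p x (?i x) = e"
      using L_inverses(1)[of e x e] e that by (simp add: homotope_def idem_right closed)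
    show "?i (?i x) = x"
      using L_inverses(2)[of e "?i x" x] L_inverses(2)[of e x e] e that
      by (simp add: idem_right closed)
  qed
  \<comment> \<open>The left Moufang identity is applied with \<open>a = b^-1\<close>: then
    \<open>(w a e)\<close> is right multiplication by \<open>b\<close>, and \<open>(xb)a\<close>
    collapses to \<open>x\<close>.\<close>
  define a where "a = ?i b"
  have a: "a \<in> M" "?i a = b"
    using * e inv by (auto simp: a_def closed)
  have xb: "t (?p x b) e a = x"
    using R_inverses(2)[of e b x] * e by (simp add: a_def homotope_def)
  have right_mult_b: "t w a e = ?p w b" if "w \<in> M" for w
    using product_via_homotope[of e w a e] that a * e by (simp add: homotope_def idem_right)
  \<comment> \<open>The middle factor of the left Moufang identity is \<open>(e e a) = a\<close>.
    Expanding \<open>t x a\<close> in the homotope then turns this equation into right Bol.\<close>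
  have "t x a (?p z b) = ?p (?p (?p x b) z) b"
    using left_Moufang[of "?p x b" e z a e] xb a * e
    by (simp add: right_mult_b idem_left closed) (simp add: homotope_def right_mult_b closed)
  then show "?p (?p (?p x b) z) b = ?p x (?p b (?p z b))"
    using product_via_homotope[of e x a "?p z b"] a * e by (simp add: homotope_def closed)
qed (use e in \<open>auto simp: homotope_def closed idem_left idem_right L_inverses R_inverses\<close>)

lemma homotope_binary_Moufang_loop: "e \<in> M \<Longrightarrow> binary_Moufang_loop M (homotope t e)"
  by (rule inverse_property_Bol_loop.is_binary_Moufang_loop[OF homotope_is_Bol_loop])

lemma homotope_inverse: "\<lbrakk>e \<in> M; y \<in> M\<rbrakk> \<Longrightarrow> is_inverse_of M (homotope t e) (t e y e) y"
  by (rule inverse_property_Bol_loop.is_inverse[OF homotope_is_Bol_loop])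

text \<open>In the homotope at \<open>b\<close> the two maps are left and right multiplication by
  \<open>a\<close>, so commuting is flexibility.\<close>

lemma L_R_commute:
  assumes "a \<in> M" "b \<in> M"
  shows "Bmap M t a b = compose M (Rmap M t a b) (Lmap M t a b)"
proof -
  interpret H: inverse_property_Bol_loop M "homotope t b" "\<lambda>y. t b y b" b
    using assms by (intro homotope_is_Bol_loop)
  have "t a b (t x b a) = t (t a b x) b a" if "x \<in> M" for x
    using H.flexible[of a x] assms that by (simp add: homotope_def)
  then show ?thesis
    using assms by (auto simp: Bmap_def compose_def Lmap_def Rmap_def closed intro!: restrict_ext)
qed

text \<open>In the homotope at \<open>b\<close> the claim reads
  \<open>a(x(y^-1 z)) = (a(xa))((a(ya))^-1 (az))\<close>; two uses of left Bol reduce the right-hand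
  side to the left.\<close>

lemma L_autotopy:
  assumes ab: "a \<in> M" "b \<in> M"
  shows "autotopy M t (Bmap M t a b) (Bmap M t a b) (Lmap M t a b) (Lmap M t a b)"
proof -
  interpret H: inverse_property_Bol_loop M "homotope t b" "\<lambda>y. t b y b" b
    using ab by (intro homotope_is_Bol_loop)
  let ?p = "homotope t b" and ?i = "\<lambda>y. t b y b"
  have L: "Lmap M t a b x = ?p a x" and B: "Bmap M t a b x = ?p a (?p x a)" if "x \<in> M" for x
    using that ab by (simp_all add: Lmap_def Bmap_def Rmap_def compose_def homotope_def closed)
  have "bij_betw (Bmap M t a b) M M"
    unfolding Bmap_def by (rule bij_betw_compose[OF bij_R[OF ab] bij_L[OF ab]])
  moreover have "?p a (t x y z) = t (?p a (?p x a)) (?p a (?p y a)) (?p a z)"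
    if "x \<in> M" "y \<in> M" "z \<in> M" for x y z
  proof -
    \<comment> \<open>Here \<open>(a(ya))^-1 = a^-1(y^-1 a^-1)\<close>, and left Bol lets its last
      \<open>a^-1\<close> cancel against \<open>az\<close>.\<close>
    have "?p (?i (?p a (?p y a))) (?p a z) = ?p (?i a) (?p (?i y) z)"
      using ab that H.left_Bol[of "?p a z" "?i a" "?i y"] by (simp add: H.inv_mult H.flexible)
    \<comment> \<open>Left Bol once more: the inner \<open>a\<close> cancels the \<open>a^-1\<close>
      in front of \<open>w\<close>, to be taken as \<open>y^-1 z\<close>.\<close>
    moreover have "?p (?p a (?p x a)) (?p (?i a) w) = ?p a (?p x w)" if "w \<in> M" for w
      using ab that \<open>x \<in> M\<close> by (simp add: H.left_Bol)
    ultimately show ?thesis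
      using that ab product_via_homotope[of b x y z]
        product_via_homotope[of b "?p a (?p x a)" "?p a (?p y a)" "?p a z"] by simp
  qed
  ultimately show ?thesis
    unfolding autotopy_def using bij_L[OF ab] L B by (simp add: closed)
qed

lemma sandwich_via_homotope:
  assumes "e \<in> M" "x \<in> M" "y \<in> M"
  shows "t x y x = homotope t e x (homotope t e (t e y e) x)"
    and "t x y x = homotope t e (homotope t e x (t e y e)) x"
proof -
  interpret H: inverse_property_Bol_loop M "homotope t e" "\<lambda>y. t e y e" e
    using assms by (intro homotope_is_Bol_loop)
  show "t x y x = homotope t e x (homotope t e (t e y e) x)"
    using assms by (intro product_via_homotope)
  then show "t x y x = homotope t e (homotope t e x (t e y e)) x"
    using assms by (simp add: H.flexible)
qed

text \<open>Based at the reflecting point \<open>x\<close>, the reflection is inversion in the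
  homotope. Involutivity is double inversion, and conjugation becomes
  \<open>(y(zy))^-1 = y^-1(z^-1 y^-1)\<close>.\<close>

lemma sandwich_reflection_space: "reflection_space M (\<lambda>x y. Smap M t x x y)"
proof
  fix x y z assume *: "x \<in> M" "y \<in> M"
  interpret H: inverse_property_Bol_loop M "homotope t x" "\<lambda>y. t x y x" x
    using * by (intro homotope_is_Bol_loop)
  show "Smap M t x x y \<in> M" "Smap M t x x x = x" "Smap M t x x (Smap M t x x y) = y"
    using * by (auto simp: Smap_def closed idem_right)
  assume "z \<in> M"
  with * show "Smap M t x x (Smap M t y y (Smap M t x x z)) =
      Smap M t (Smap M t x x y) (Smap M t x x y) z"
    using product_via_homotope[of x y "t x z x" y] product_via_homotope[of x "t x y x" z "t x y x"]
    by (simp add: Smap_def closed H.inv_mult H.flexible)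
qed

text \<open>All right multiplications of \<open>t\<close> are right multiplications of the single
  homotope at \<open>b\<close>, where right Bol collapses \<open>((xa)g^-1)a\<close> to
  \<open>x(a(g^-1 a))\<close>.\<close>

lemma R_stable: "stable_fginvf M {Rmap M t a b | a b. a \<in> M \<and> b \<in> M}"
  unfolding stable_fginvf_def
proof clarify
  fix a b c d assume *: "a \<in> M" "b \<in> M" "c \<in> M" "d \<in> M"
  interpret H: inverse_property_Bol_loop M "homotope t b" "\<lambda>y. t b y b" b
    using * by (intro homotope_is_Bol_loop)
  let ?p = "homotope t b" and ?i = "\<lambda>y. t b y b"
  \<comment> \<open>From \<open>(xdc) = x(d^-1 c)\<close>: this is the element by which
    \<open>Rmap M t c d\<close> multiplies on the right.\<close>
  define g where "g = ?p (?i d) c"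
  have g: "g \<in> M"
    using * by (simp add: g_def)
  have R_ab: "Rmap M t a b x = ?p x a" and R_cd: "Rmap M t c d x = ?p x g" if "x \<in> M" for x
    using that * product_via_homotope[of b x d c]
    by (simp_all add: Rmap_def homotope_def g_def)
  have inv: "inv_into M (Rmap M t c d) x = ?p x (?i g)" if "x \<in> M" for x
    by (rule inv_into_f_eq) (use that g * bij_R[of c d] R_cd in \<open>auto simp: bij_betw_def\<close>)
  define h where "h = ?p a (?p (?i g) a)"
  have "compose M (Rmap M t a b) (compose M (restrict (inv_into M (Rmap M t c d)) M) (Rmap M t a b))
      = Rmap M t h b"
  proof
    fix x
    show "compose M (Rmap M t a b)
        (compose M (restrict (inv_into M (Rmap M t c d)) M) (Rmap M t a b)) x = Rmap M t h b x"
    proof (cases "x \<in> M")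
      case True
      then show ?thesis
        using * g by (simp add: compose_def R_ab inv H.right_Bol h_def)
          (simp add: Rmap_def homotope_def)
    qed (simp add: compose_def Rmap_def)
  qed
  moreover have "h \<in> M"
    using * g by (simp add: h_def)
  ultimately show "\<exists>a' b'. compose M (Rmap M t a b)
      (compose M (restrict (inv_into M (Rmap M t c d)) M) (Rmap M t a b)) = Rmap M t a' b'
      \<and> a' \<in> M \<and> b' \<in> M"
    using * by blast
qed

end

section \<open>Right ternary Moufang loops as opposites of left ones\<close>

definition opposite :: "'a ternary \<Rightarrow> 'a ternary" where
  "opposite t = (\<lambda>x y z. t z y x)"

text \<open>Thanks to the index order in \<open>Rmap\<close>, reversal exchanges \<open>L\<close>
  and \<open>R\<close> without permuting their indices.\<close>

lemma opposite_simps: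
  "opposite t x y z = t z y x"
  "Lmap M (opposite t) = Rmap M t" "Rmap M (opposite t) = Lmap M t"
  "Smap M (opposite t) x z = Smap M t z x"
  "homotope (opposite t) e = (\<lambda>x z. homotope t e z x)"
  by (simp_all add: opposite_def fun_eq_iff Lmap_def Rmap_def Smap_def homotope_def)

lemma autotopy_opposite: "autotopy M (opposite t) f1 f2 f3 f0 \<longleftrightarrow> autotopy M t f3 f2 f1 f0"
  by (auto simp: autotopy_def opposite_def)

context right_ternary_Moufang_loop
begin

text \<open>Each left axiom for \<open>opposite t\<close> is a right axiom for \<open>t\<close> read
  backwards, with \<open>a\<close> and \<open>b\<close> exchanged in the Moufang identity.\<close>

sublocale opp: left_ternary_Moufang_loop M "opposite t"
  by unfold_locales
    (simp_all add: opposite_simps closed bij_L bij_R bij_S idem_left idem_right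
      L_inverse_left L_inverse_right R_inverse_left R_inverse_right right_Chasles right_Moufang)

lemma R_L_commute:
  assumes "a \<in> M" "b \<in> M"
  shows "Bmap M t a b = compose M (Rmap M t a b) (Lmap M t a b)"
  using opp.L_R_commute[OF assms] by (simp add: Bmap_def opposite_simps)

lemma R_autotopy:
  assumes "a \<in> M" "b \<in> M"
  shows "autotopy M t (Rmap M t a b) (Bmap M t a b) (Bmap M t a b) (Rmap M t a b)"
proof -
  \<comment> \<open>\<open>Bmap\<close> applies \<open>R\<close> first and then \<open>L\<close>;
    reversal swaps this order, so commutation is what identifies the two maps.\<close>
  have "Bmap M (opposite t) a b = Bmap M t a b"
    using R_L_commute[OF assms] by (simp add: Bmap_def opposite_simps)
  then show ?thesis
    using opp.L_autotopy[OF assms] by (simp add: autotopy_opposite opposite_simps)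
qed

end

section \<open>The claims for both handednesses, the right-handed ones by reversal\<close>

theorem theoremA12:
  fixes M :: "'a set" and t :: "'a \<Rightarrow> 'a \<Rightarrow> 'a \<Rightarrow> 'a"
  shows
   "(left_ternary_Moufang_loop M t \<or> right_ternary_Moufang_loop M t \<longrightarrow>
       (\<forall>e\<in>M. binary_Moufang_loop M (homotope t e)))
  \<and>
    (left_ternary_Moufang_loop M t \<longrightarrow>
       (\<forall>e\<in>M. (\<forall>y\<in>M. is_inverse_of M (homotope t e) (t e y e) y) \<and>
          (\<forall>x\<in>M. \<forall>y\<in>M. \<forall>z\<in>M.
             t x y z = homotope t e x (homotope t e (t e y e) z))))
  \<and>
    (right_ternary_Moufang_loop M t \<longrightarrow>
       (\<forall>e\<in>M. (\<forall>y\<in>M. is_inverse_of M (homotope t e) (t e y e) y) \<and>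
          (\<forall>x\<in>M. \<forall>y\<in>M. \<forall>z\<in>M.
             t x y z = homotope t e (homotope t e x (t e y e)) z)))
  \<and>
    (left_ternary_Moufang_loop M t \<longrightarrow>
       (\<forall>a\<in>M. \<forall>b\<in>M.
          Bmap M t a b = compose M (Rmap M t a b) (Lmap M t a b) \<and>
          autotopy M t (Bmap M t a b) (Bmap M t a b) (Lmap M t a b) (Lmap M t a b)))
  \<and>
    (right_ternary_Moufang_loop M t \<longrightarrow>
       (\<forall>a\<in>M. \<forall>b\<in>M.
          Bmap M t a b = compose M (Rmap M t a b) (Lmap M t a b) \<and>
          autotopy M t (Rmap M t a b) (Bmap M t a b) (Bmap M t a b) (Rmap M t a b)))
  \<and>
    (left_ternary_Moufang_loop M t \<or> right_ternary_Moufang_loop M t \<longrightarrow>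
       reflection_space M (\<lambda>x y. Smap M t x x y) \<and>
       (\<forall>x\<in>M. \<forall>y\<in>M. Smap M t x x y = t x y x \<and>
          (\<forall>e\<in>M.
             t x y x = homotope t e x (homotope t e (t e y e) x) \<and>
             t x y x = homotope t e (homotope t e x (t e y e)) x)))
  \<and>
    (left_ternary_Moufang_loop M t \<longrightarrow>
       stable_fginvf M {Rmap M t a b | a b. a \<in> M \<and> b \<in> M})
  \<and>
    (right_ternary_Moufang_loop M t \<longrightarrow>
       stable_fginvf M {Lmap M t a b | a b. a \<in> M \<and> b \<in> M})"
proof (intro conjI)
  show "left_ternary_Moufang_loop M t \<or> right_ternary_Moufang_loop M t \<longrightarrow>
      (\<forall>e\<in>M. binary_Moufang_loop M (homotope t e))"
  proof (intro impI ballI, elim disjE)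
    fix e assume "e \<in> M" "left_ternary_Moufang_loop M t"
    then show "binary_Moufang_loop M (homotope t e)"
      by (rule left_ternary_Moufang_loop.homotope_binary_Moufang_loop[rotated])
  next
    fix e assume e: "e \<in> M" and "right_ternary_Moufang_loop M t"
    then interpret right_ternary_Moufang_loop M t by simp
    show "binary_Moufang_loop M (homotope t e)"
      \<comment> \<open>The homotope of \<open>opposite t\<close> is the opposite of the homotope of
        \<open>t\<close>, so it is reversed once more.\<close>
      using binary_Moufang_loop.opposite[OF opp.homotope_binary_Moufang_loop[OF e]]
      by (simp add: opposite_simps)
  qed
next
  show "left_ternary_Moufang_loop M t \<longrightarrow>
       (\<forall>e\<in>M. (\<forall>y\<in>M. is_inverse_of M (homotope t e) (t e y e) y) \<and>
          (\<forall>x\<in>M. \<forall>y\<in>M. \<forall>z\<in>M.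
             t x y z = homotope t e x (homotope t e (t e y e) z)))"
    by (blast intro: left_ternary_Moufang_loop.homotope_inverse
        left_ternary_Moufang_loop.product_via_homotope)
next
  show "right_ternary_Moufang_loop M t \<longrightarrow>
       (\<forall>e\<in>M. (\<forall>y\<in>M. is_inverse_of M (homotope t e) (t e y e) y) \<and>
          (\<forall>x\<in>M. \<forall>y\<in>M. \<forall>z\<in>M.
             t x y z = homotope t e (homotope t e x (t e y e)) z))"
  proof
    assume "right_ternary_Moufang_loop M t"
    then interpret right_ternary_Moufang_loop M t .
    show "\<forall>e\<in>M. (\<forall>y\<in>M. is_inverse_of M (homotope t e) (t e y e) y) \<and>
          (\<forall>x\<in>M. \<forall>y\<in>M. \<forall>z\<in>M.
             t x y z = homotope t e (homotope t e x (t e y e)) z)"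
    proof (intro ballI conjI)
      fix e y assume *: "e \<in> M" "y \<in> M"
      show "is_inverse_of M (homotope t e) (t e y e) y"
        using opp.homotope_inverse[OF *] is_inverse_of_opposite[of M "homotope t e"]
        by (simp add: opposite_simps)
    next
      fix e x y z assume *: "e \<in> M" "x \<in> M" "y \<in> M" "z \<in> M"
      show "t x y z = homotope t e (homotope t e x (t e y e)) z"
        \<comment> \<open>The left formula for \<open>(zyx)\<close> in the reversed product, read
          backwards.\<close>
        using opp.product_via_homotope[OF *(1,4,3,2)] by (simp add: opposite_simps)
    qed
  qed
next
  show "left_ternary_Moufang_loop M t \<longrightarrow>
       (\<forall>a\<in>M. \<forall>b\<in>M.
          Bmap M t a b = compose M (Rmap M t a b) (Lmap M t a b) \<and>
          autotopy M t (Bmap M t a b) (Bmap M t a b) (Lmap M t a b) (Lmap M t a b))"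
    by (intro impI ballI conjI left_ternary_Moufang_loop.L_R_commute
        left_ternary_Moufang_loop.L_autotopy)
next
  show "right_ternary_Moufang_loop M t \<longrightarrow>
       (\<forall>a\<in>M. \<forall>b\<in>M.
          Bmap M t a b = compose M (Rmap M t a b) (Lmap M t a b) \<and>
          autotopy M t (Rmap M t a b) (Bmap M t a b) (Bmap M t a b) (Rmap M t a b))"
    by (intro impI ballI conjI right_ternary_Moufang_loop.R_L_commute
        right_ternary_Moufang_loop.R_autotopy)
next
  show "left_ternary_Moufang_loop M t \<or> right_ternary_Moufang_loop M t \<longrightarrow>
       reflection_space M (\<lambda>x y. Smap M t x x y) \<and>
       (\<forall>x\<in>M. \<forall>y\<in>M. Smap M t x x y = t x y x \<and>
          (\<forall>e\<in>M.
             t x y x = homotope t e x (homotope t e (t e y e) x) \<and>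
             t x y x = homotope t e (homotope t e x (t e y e)) x))"
    (is "_ \<longrightarrow> ?refl \<and> ?formulas")
  proof (intro impI, elim disjE)
    assume "left_ternary_Moufang_loop M t"
    then interpret left_ternary_Moufang_loop M t .
    show "?refl \<and> ?formulas"
      by (intro conjI ballI sandwich_reflection_space sandwich_via_homotope) (simp_all add: Smap_def)
  next
    assume "right_ternary_Moufang_loop M t"
    then interpret right_ternary_Moufang_loop M t .
    show "?refl \<and> ?formulas"
      \<comment> \<open>The word \<open>xyx\<close> is a palindrome: reversal fixes the reflection
        and interchanges the two homotope formulas.\<close>
      using opp.sandwich_reflection_space
      by (intro conjI ballI opp.sandwich_via_homotope[unfolded opposite_simps])
        (simp_all add: Smap_def opposite_simps)
  qed
next
  show "left_ternary_Moufang_loop M t \<longrightarrow>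
       stable_fginvf M {Rmap M t a b | a b. a \<in> M \<and> b \<in> M}"
    using left_ternary_Moufang_loop.R_stable by blast
next
  show "right_ternary_Moufang_loop M t \<longrightarrow>
       stable_fginvf M {Lmap M t a b | a b. a \<in> M \<and> b \<in> M}"
  proof
    assume "right_ternary_Moufang_loop M t"
    then interpret right_ternary_Moufang_loop M t .
    show "stable_fginvf M {Lmap M t a b | a b. a \<in> M \<and> b \<in> M}"
      using opp.R_stable by (simp add: opposite_simps)
  qed
qed

end
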